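(* Let $D\ge 1$ and $d\ge 2$ be integers. If $\mathbf{s}\in\{0,\ldots,D-1\}^\infty$ is a full template, then $\mathcal{M}^{\mathbf{s}}$ is a compact subset of $\overline{\mathrm{D}}(0,2)^D\times\{2,\ldots,d\}^D$.
   Context: $\overline{\mathrm{D}}(0,2)\subset\mathbb{C}$ is the closed disc of centre $0$ and radius $2$; $\{2,\ldots,d\}^D$ has the discrete topology. Templates: a template is a sequence $\mathbf{s}=\{s_m\}_{m=1}^\infty\in\{0,\ldots,D-1\}^\infty$. It is called full if for each $0\le i\le D-1$ there is at least one $m\ge 1$ with $s_m=i$. Template iteration: for $\mathbf{c}=(c_0,\ldots,c_{D-1})\in\mathbb{C}^D$ and $\mathbf{d}=(d_0,\ldots,d_{D-1})\in\{2,\ldots,d\}^D$, put $f_{(c_i,d_i)}(z)=z^{d_i}+c_i$. For a template $\mathbf{s}$ let $P_m^{\mathbf{s},\mathbf{c},\mathbf{d}}=f_{(c_{s_m},d_{s_m})}$ for $m\ge 1$, and for $0\le m<n$ let $Q_{m,n}^{\mathbf{s},\mathbf{c},\mathbf{d}}=P_n^{\mathbf{s},\mathbf{c},\mathbf{d}}\circ\cdots\circ P_{m+1}^{\mathbf{s},\mathbf{c},\mathbf{d}}$ (with $Q_{m,m}$ the identity). Fixed-template Mandelbrot set (with degree bound $d$): $\mathcal{M}^{\mathbf{s}}$ is the set of all $(\mathbf{c},\mathbf{d})\in\mathbb{C}^D\times\{2,\ldots,d\}^D$ such that for every $m\ge 0$ the sequence $\{Q_{m,n}^{\mathbf{s},\mathbf{c},\mathbf{d}}(0)\}_{n\ge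 m}$ is bounded. *)

theory Defs
  imports "HOL-Analysis.Analysis"
begin

text \<open>
  The index set of the \<open>D\<close> coordinates is the finite type \<open>'n\<close>, so that \<open>D = CARD('n) \<ge> 1\<close>;
  the labels \<open>0, \<dots>, D - 1\<close> themselves play no role.  Templates are sequences indexed by \<open>m \<ge> 1\<close>;
  they are modelled as functions on \<^typ>\<open>nat\<close> whose value at \<open>0\<close> is never used.
\<close>

definition full_template :: "(nat \<Rightarrow> 'n) \<Rightarrow> bool" where
  "full_template s \<longleftrightarrow> (\<forall>i. \<exists>m\<ge>1. s m = i)"

definition unicritical :: "complex \<Rightarrow> nat \<Rightarrow> complex \<Rightarrow> complex" where
  "unicritical c k z = z ^ k + c"

definition template_map ::
    "(nat \<Rightarrow> 'n::finite) \<Rightarrow> complex ^ 'n \<Rightarrow> nat ^ 'n \<Rightarrow> nat \<Rightarrow> complex \<Rightarrow> complex" where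
  "template_map s c k m = unicritical (c $ s m) (k $ s m)"

text \<open>
  \<open>template_iter s c k m n\<close> is the composition of the maps with indices \<open>m + 1, \<dots>, n\<close>;
  it is only meaningful for \<open>m \<le> n\<close>, and is set to the identity for \<open>n < m\<close>.
\<close>

primrec template_iter ::
    "(nat \<Rightarrow> 'n::finite) \<Rightarrow> complex ^ 'n \<Rightarrow> nat ^ 'n \<Rightarrow> nat \<Rightarrow> nat \<Rightarrow> complex \<Rightarrow> complex" where
  "template_iter s c k m 0 = id"
| "template_iter s c k m (Suc n) =
     (if m \<le> n then template_map s c k (Suc n) \<circ> template_iter s c k m n else id)"

definition degree_vectors :: "nat \<Rightarrow> (nat ^ 'n::finite) set" where
  "degree_vectors d = {k. \<forall>i. k $ i \<in> {2..d}}"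

definition polydisc2 :: "(complex ^ 'n::finite) set" where
  "polydisc2 = {c. \<forall>i. c $ i \<in> cball 0 2}"

text \<open>
  The topology of \<^typ>\<open>nat ^ 'n\<close> is the finite product of discrete ones, hence discrete, so
  \<^typ>\<open>(complex ^ 'n) \<times> (nat ^ 'n)\<close> induces on \<open>UNIV \<times> degree_vectors d\<close> the product of the
  usual topology with the discrete one.
\<close>

definition template_mandelbrot ::
    "nat \<Rightarrow> (nat \<Rightarrow> 'n::finite) \<Rightarrow> ((complex ^ 'n) \<times> (nat ^ 'n)) set" where
  "template_mandelbrot d s =
     {(c, k). k \<in> degree_vectors d \<and>
        (\<forall>m. bounded ((\<lambda>n. template_iter s c k m n 0) ` {m..}))}"

end

theory Submission
  imports Defs
begin

text \<open>
  The proof rests on the usual escape criterion, applied to compositions of varying polynomials: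
  if an orbit reaches a point \<open>z\<close> with \<open>\<bar>z\<bar> > 2\<close> and no parameter has modulus larger than \<open>\<bar>z\<bar>\<close>,
  then the moduli grow at least by the factor \<open>\<bar>z\<bar> - 1 > 1\<close> in each further step
  (\<open>unicritical_growth\<close>, \<open>template_escape\<close>).

  The criterion is used twice. If some parameter has modulus larger than \<open>2\<close>, choose one, \<open>c\<^sub>i\<close>,
  of maximal modulus. By fullness, \<open>i\<close> occurs in the template, say at position \<open>m + 1\<close>, and then the
  critical orbit started at time \<open>m\<close> passes through \<open>c\<^sub>i\<close> at time \<open>m + 1\<close> and escapes. Hence all
  parameters lie in the disc of radius \<open>2\<close>. Therefore every orbit leaving that disc escapes,
  so that the Mandelbrot set is described by the inequalities \<open>\<bar>Q\<^sub>m\<^sub>,\<^sub>n(0)\<bar> \<le> 2\<close>. For each fixed degree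
  vector these are closed conditions on \<open>\<^bold>c\<close>, since \<open>Q\<^sub>m\<^sub>,\<^sub>n(0)\<close> depends continuously on \<open>\<^bold>c\<close>. The
  Mandelbrot set is thus a union of finitely many compact slices, one for each degree vector.
\<close>

lemma unicritical_growth:
  fixes z c :: complex
  assumes r: "2 < r" and z: "r \<le> norm z" and c: "norm c \<le> r" and k: "2 \<le> k"
  shows "(r - 1) * norm z \<le> norm (unicritical c k z)"
proof -
  have "(r - 1) * norm z \<le> norm z * norm z - norm z"
    using mult_right_mono[OF z, of "norm z"] by (simp add: algebra_simps)
  also have "\<dots> \<le> norm z ^ 2 - norm c"
    using z c by (simp add: power2_eq_square)
  also have "\<dots> \<le> norm z ^ k - norm c"
    using power_increasing[OF k, of "norm z"] r z by simp
  also have "\<dots> \<le> norm (unicritical c k z)"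
    using norm_diff_ineq[of "z ^ k" c] by (simp add: unicritical_def norm_power)
  finally show ?thesis .
qed

lemma template_iter_self [simp]: "template_iter s c k m m = id"
  by (cases m) auto

lemma template_iter_step:
  "m \<le> n \<Longrightarrow> template_iter s c k m (Suc n) z =
     template_iter s c k m n z ^ (k $ s (Suc n)) + c $ s (Suc n)"
  by (simp add: template_map_def unicritical_def)

lemma template_iter_one:
  assumes "k \<in> degree_vectors d"
  shows "template_iter s c k m (Suc m) 0 = c $ s (Suc m)"
proof -
  \<comment> \<open>Exponent \<open>0\<close> has to be excluded, since \<open>0 ^ 0 = 1\<close>.\<close>
  have "2 \<le> k $ s (Suc m)"
    using assms by (simp add: degree_vectors_def)
  then show ?thesis
    by (simp add: template_map_def unicritical_def)
qed

lemma template_escape: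
  assumes k: "k \<in> degree_vectors d" and mN: "m \<le> N"
    and r: "2 < norm (template_iter s c k m N 0)"
    and c: "\<And>i. norm (c $ i) \<le> norm (template_iter s c k m N 0)"
  shows "\<not> bounded ((\<lambda>n. template_iter s c k m n 0) ` {m..})"
proof
  let ?z = "\<lambda>n. template_iter s c k m n 0"
  define r where "r = norm (?z N)"
  have r2: "2 < r" using r by (simp add: r_def)
  have growth: "(r - 1) ^ j * r \<le> norm (?z (N + j))" for j
  proof (induction j)
    case 0
    then show ?case by (simp add: r_def)
  next
    case (Suc j)
    have "1 * r \<le> (r - 1) ^ j * r"
      using r2 by (intro mult_right_mono one_le_power) auto
    then have large: "r \<le> norm (?z (N + j))"
      using Suc.IH by linarith
    have "(r - 1) ^ Suc j * r \<le> (r - 1) * norm (?z (N + j))"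
      using mult_left_mono[OF Suc.IH, of "r - 1"] r2 by (simp add: mult.assoc)
    also have "\<dots> \<le> norm (unicritical (c $ s (Suc (N + j))) (k $ s (Suc (N + j))) (?z (N + j)))"
      using large r2 c k by (intro unicritical_growth) (auto simp: r_def degree_vectors_def)
    also have "\<dots> = norm (?z (N + Suc j))"
      using mN by (simp add: template_map_def)
    finally show ?case .
  qed
  assume "bounded (?z ` {m..})"
  then obtain B where B: "\<And>n. m \<le> n \<Longrightarrow> norm (?z n) \<le> B"
    by (auto simp: bounded_iff)
  obtain j where j: "B < (r - 1) ^ j"
    using real_arch_pow[of "r - 1" B] r2 by auto
  have "(r - 1) ^ j * 1 \<le> (r - 1) ^ j * r"
    using r2 by (intro mult_left_mono) auto
  also have "\<dots> \<le> B"
    using growth[of j] B[of "N + j"] mN by linarith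
  finally show False using j by simp
qed

lemma template_mandelbrot_parameter_le_2:
  assumes s: "full_template s" and M: "(c, k) \<in> template_mandelbrot d s"
  shows "norm (c $ i) \<le> 2"
proof (rule ccontr)
  assume "\<not> norm (c $ i) \<le> 2"
  define R where "R = Max (range (\<lambda>j. norm (c $ j)))"
  have max: "norm (c $ j) \<le> R" for j
    unfolding R_def by (intro Max_ge) auto
  have "R \<in> range (\<lambda>j. norm (c $ j))"
    unfolding R_def by (intro Max_in) auto
  then obtain j where j: "norm (c $ j) = R" by auto
  obtain n where "n \<ge> 1" and "s n = j"
    using s by (auto simp: full_template_def)
  then obtain m where m: "s (Suc m) = j"
    by (cases n) auto
  have k: "k \<in> degree_vectors d"
    and bdd: "bounded ((\<lambda>n. template_iter s c k m n 0) ` {m..})"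
    using M by (auto simp: template_mandelbrot_def)
  have "norm (template_iter s c k m (Suc m) 0) = R"
    unfolding template_iter_one[OF k] m j ..
  moreover have "2 < R"
    using \<open>\<not> norm (c $ i) \<le> 2\<close> max[of i] by linarith
  ultimately show False
    using template_escape[OF k, of m "Suc m" s c] max bdd by (auto simp del: template_iter.simps)
qed

lemma mem_template_mandelbrot_iff:
  assumes s: "full_template s"
  shows "(c, k) \<in> template_mandelbrot d s \<longleftrightarrow>
    k \<in> degree_vectors d \<and> (\<forall>m. \<forall>n\<ge>m. norm (template_iter s c k m n 0) \<le> 2)"
proof
  assume M: "(c, k) \<in> template_mandelbrot d s"
  then have k: "k \<in> degree_vectors d"
    and bdd: "\<And>m. bounded ((\<lambda>n. template_iter s c k m n 0) ` {m..})"
    by (auto simp: template_mandelbrot_def)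
  have "norm (template_iter s c k m n 0) \<le> 2" if "m \<le> n" for m n
  proof (rule ccontr)
    assume "\<not> ?thesis"
    then have large: "2 < norm (template_iter s c k m n 0)" by simp
    have "norm (c $ i) \<le> norm (template_iter s c k m n 0)" for i
      using template_mandelbrot_parameter_le_2[OF s M, of i] large by linarith
    from template_escape[OF k that large this] bdd show False by blast
  qed
  with k show "k \<in> degree_vectors d \<and> (\<forall>m. \<forall>n\<ge>m. norm (template_iter s c k m n 0) \<le> 2)"
    by blast
next
  assume "k \<in> degree_vectors d \<and> (\<forall>m. \<forall>n\<ge>m. norm (template_iter s c k m n 0) \<le> 2)"
  then show "(c, k) \<in> template_mandelbrot d s"
    by (auto simp: template_mandelbrot_def bounded_iff)
qed

lemma continuous_on_template_iter:
  "continuous_on UNIV (\<lambda>c. template_iter s c k m n z)"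
proof (induction n)
  case 0
  then show ?case by simp
next
  case (Suc n)
  show ?case
  proof (cases "m \<le> n")
    case True
    have "continuous_on UNIV (\<lambda>c. template_iter s c k m n z ^ (k $ s (Suc n)) + c $ s (Suc n))"
      by (intro continuous_intros Suc.IH)
    then show ?thesis
      using True by (simp only: template_iter_step)
  next
    case False
    then show ?thesis by simp
  qed
qed

lemma finite_degree_vectors: "finite (degree_vectors d :: (nat ^ 'n::finite) set)"
proof (rule finite_subset)
  show "degree_vectors d \<subseteq> vec_lambda ` (UNIV \<rightarrow>\<^sub>E {2..d} :: ('n \<Rightarrow> nat) set)"
  proof
    fix k :: "nat ^ 'n"
    assume "k \<in> degree_vectors d"
    then have "vec_nth k \<in> UNIV \<rightarrow>\<^sub>E {2..d}"
      by (auto simp: degree_vectors_def)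
    moreover have "k = vec_lambda (vec_nth k)"
      by simp
    ultimately show "k \<in> vec_lambda ` (UNIV \<rightarrow>\<^sub>E {2..d})"
      by blast
  qed
qed (intro finite_imageI finite_PiE; simp)

lemma bounded_polydisc2: "bounded (polydisc2 :: (complex ^ 'n::finite) set)"
  unfolding bounded_iff
proof (intro exI ballI)
  fix c :: "complex ^ 'n"
  assume c: "c \<in> polydisc2"
  have "norm c \<le> (\<Sum>i\<in>UNIV. norm (c $ i))"
    by (simp add: norm_vec_def L2_set_le_sum)
  also have "\<dots> \<le> (\<Sum>i\<in>(UNIV :: 'n set). 2)"
    using c by (intro sum_mono) (simp add: polydisc2_def)
  finally show "norm c \<le> (\<Sum>i\<in>(UNIV :: 'n set). 2)" .
qed

theorem lemma2p2:
  fixes s :: "nat \<Rightarrow> 'n::finite" and d :: nat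
  assumes "d \<ge> 2" and "full_template s"
  shows "compact (template_mandelbrot d s) \<and>
         template_mandelbrot d s \<subseteq> polydisc2 \<times> degree_vectors d"
proof
  show sub: "template_mandelbrot d s \<subseteq> polydisc2 \<times> degree_vectors d"
    using template_mandelbrot_parameter_le_2[OF assms(2)]
    by (auto simp: polydisc2_def template_mandelbrot_def)
  define S where "S k = {c. (c, k) \<in> template_mandelbrot d s}" for k
  have "compact (S k)" if k: "k \<in> degree_vectors d" for k
  proof -
    have "S k = (\<Inter>m. \<Inter>n\<in>{m..}. {c. norm (template_iter s c k m n 0) \<le> 2})"
      using k by (auto simp: S_def mem_template_mandelbrot_iff[OF assms(2)])
    moreover have "closed {c. norm (template_iter s c k m n 0) \<le> 2}" for m n
      by (intro closed_Collect_le continuous_intros continuous_on_template_iter)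
    ultimately have "closed (S k)"
      by (auto intro!: closed_INT)
    moreover have "bounded (S k)"
      by (rule bounded_subset[OF bounded_polydisc2]) (use sub in \<open>auto simp: S_def\<close>)
    ultimately show ?thesis
      by (simp add: compact_eq_bounded_closed)
  qed
  then have "compact (\<Union>k\<in>degree_vectors d. S k \<times> {k})"
    by (intro compact_UN finite_degree_vectors compact_Times) auto
  also have "(\<Union>k\<in>degree_vectors d. S k \<times> {k}) = template_mandelbrot d s"
    using sub by (auto simp: S_def)
  finally show "compact (template_mandelbrot d s)" .
qed

end
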